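(* Let $n\ge 2$, let $P_n$ be the path graph on $n$ vertices with vertex set $X=\{1,\dots,n\}$, and let $m\in X$. Suppose $n>2m-1$. Then $\mathcal{T}_2(P_n,m)=\mathcal{T}_3(P_n,m)=\mathcal{T}_4(P_n,m)=M_X(\mathbb{C})$.
   Context: $P_n$ has vertex set $X=\{1,2,\dots,n\}$ and edge set $\{\{i,j\}: |i-j|=1\}$. For a finite connected simple graph $\Gamma$ on $X$ with adjacency matrix $A$ and base vertex $x_0\in X$, $M_X(\mathbb{C})$ is the algebra of complex matrices with rows and columns indexed by $X$. For $Y\subset X$, $E_Y$ is the diagonal matrix with $(x,x)$-entry $1$ if $x\in Y$ and $0$ otherwise. $\mathbb{C}\langle S\rangle$ is the unital $\mathbb{C}$-subalgebra of $M_X(\mathbb{C})$ generated by $S$. Let $X_k=\{x\in X:\partial(x_0,x)=k\}$ ($\partial$ the graph distance), $D=\max_{x}\partial(x_0,x)$, $G_{x_0}$ the stabilizer of $x_0$ in $\mathrm{Aut}(\Gamma)$, and $Y_1,\dots,Y_r$ the $G_{x_0}$-orbits on $X$. Then $\mathcal{T}_2(\Gamma,x_0)=\mathbb{C}\langle A,E_{X_0},\dots,E_{X_D}\rangle$, $\mathcal{T}_3(\Gamma,x_0)=\mathbb{C}\langle A,E_{Y_1},\dots,E_{Y_r}\rangle$, and $\mathcal{T}_4(\Gamma,x_0)=\{M\in M_X(\mathbb{C}): M_{\sigma(x),\sigma(y)}=M_{x,y}\ \text{for all } x,y\in X,\ \sigma\in G_{x_0}\}$. *)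

theory Defs
  imports Complex_Main "HOL-Combinatorics.Permutations"
begin

(* A graph is a pair (vertices, edges); edges are two-element sets of vertices. *)
type_synonym 'a graph = "'a set \<times> 'a set set"

abbreviation verts :: "'a graph \<Rightarrow> 'a set" where
  "verts \<equiv> fst"

abbreviation edges :: "'a graph \<Rightarrow> 'a set set" where
  "edges \<equiv> snd"

definition path_graph :: "nat \<Rightarrow> nat graph" where
  "path_graph n =
     ({1..n}, {{i, j} | i j. i \<in> {1..n} \<and> j \<in> {1..n} \<and> \<bar>int i - int j\<bar> = 1})"

definition arcs :: "'a graph \<Rightarrow> 'a rel" where
  "arcs \<Gamma> = {(x, y). {x, y} \<in> edges \<Gamma>}"

(* Elements of arcs \<Gamma> ^^ k are the pairs of end points of walks of length k. The LEAST is
   meaningful only when some walk joins x and y, e.g. in a connected graph. *)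
definition graph_dist :: "'a graph \<Rightarrow> 'a \<Rightarrow> 'a \<Rightarrow> nat" where
  "graph_dist \<Gamma> x y = (LEAST k. (x, y) \<in> arcs \<Gamma> ^^ k)"

definition sphere_at :: "'a graph \<Rightarrow> 'a \<Rightarrow> nat \<Rightarrow> 'a set" where
  "sphere_at \<Gamma> x0 k = {x \<in> verts \<Gamma>. graph_dist \<Gamma> x0 x = k}"

definition eccentricity :: "'a graph \<Rightarrow> 'a \<Rightarrow> nat" where
  "eccentricity \<Gamma> x0 = Max (graph_dist \<Gamma> x0 ` verts \<Gamma>)"

definition automorphisms :: "'a graph \<Rightarrow> ('a \<Rightarrow> 'a) set" where
  "automorphisms \<Gamma> =
     {\<sigma>. \<sigma> permutes verts \<Gamma> \<and>
          (\<forall>x\<in>verts \<Gamma>. \<forall>y\<in>verts \<Gamma>. {\<sigma> x, \<sigma> y} \<in> edges \<Gamma> \<longleftrightarrow> {x, y} \<in> edges \<Gamma>)}"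

definition stabilizer :: "'a graph \<Rightarrow> 'a \<Rightarrow> ('a \<Rightarrow> 'a) set" where
  "stabilizer \<Gamma> x0 = {\<sigma> \<in> automorphisms \<Gamma>. \<sigma> x0 = x0}"

definition stabilizer_orbits :: "'a graph \<Rightarrow> 'a \<Rightarrow> 'a set set" where
  "stabilizer_orbits \<Gamma> x0 = {{\<sigma> x | \<sigma>. \<sigma> \<in> stabilizer \<Gamma> x0} | x. x \<in> verts \<Gamma>}"

(* A matrix with rows and columns indexed by a finite set X is represented by the function
   of its entries, extended by 0 outside X \<times> X so that distinct functions are distinct matrices. *)
type_synonym 'a cmatrix = "'a \<Rightarrow> 'a \<Rightarrow> complex"

definition matrices :: "'a set \<Rightarrow> 'a cmatrix set" where
  "matrices X = {M. \<forall>x y. x \<notin> X \<or> y \<notin> X \<longrightarrow> M x y = 0}"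

definition mat_mult :: "'a set \<Rightarrow> 'a cmatrix \<Rightarrow> 'a cmatrix \<Rightarrow> 'a cmatrix" where
  "mat_mult X M N = (\<lambda>x y. \<Sum>z\<in>X. M x z * N z y)"

definition diag_idem :: "'a set \<Rightarrow> 'a cmatrix" where
  "diag_idem Y = (\<lambda>x y. if x = y \<and> x \<in> Y then 1 else 0)"

definition adjacency_matrix :: "'a graph \<Rightarrow> 'a cmatrix" where
  "adjacency_matrix \<Gamma> =
     (\<lambda>x y. if x \<in> verts \<Gamma> \<and> y \<in> verts \<Gamma> \<and> {x, y} \<in> edges \<Gamma> then 1 else 0)"

(* The identity of the matrix algebra on X is diag_idem X. *)
definition unital_subalgebra :: "'a set \<Rightarrow> 'a cmatrix set \<Rightarrow> bool" where
  "unital_subalgebra X B \<longleftrightarrow>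
     B \<subseteq> matrices X \<and>
     diag_idem X \<in> B \<and>
     (\<forall>M\<in>B. \<forall>N\<in>B. (\<lambda>x y. M x y + N x y) \<in> B) \<and>
     (\<forall>c. \<forall>M\<in>B. (\<lambda>x y. c * M x y) \<in> B) \<and>
     (\<forall>M\<in>B. \<forall>N\<in>B. mat_mult X M N \<in> B)"

definition generated_algebra :: "'a set \<Rightarrow> 'a cmatrix set \<Rightarrow> 'a cmatrix set" where
  "generated_algebra X S = unital_subalgebra X hull S"

lemma unital_subalgebra_matrices: "unital_subalgebra X (matrices X)"
  by (auto simp: unital_subalgebra_def matrices_def diag_idem_def mat_mult_def)

(* For S inside the matrix algebra the hull is a genuine subalgebra, the least one containing S. *)
lemma unital_subalgebra_generated:
  assumes "S \<subseteq> matrices X"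
  shows "unital_subalgebra X (generated_algebra X S)"
proof -
  have "generated_algebra X S \<subseteq> matrices X"
    using assms unital_subalgebra_matrices
    unfolding generated_algebra_def by (rule hull_minimal)
  then show ?thesis
    unfolding unital_subalgebra_def generated_algebra_def hull_def by blast
qed

definition T2 :: "'a graph \<Rightarrow> 'a \<Rightarrow> 'a cmatrix set" where
  "T2 \<Gamma> x0 = generated_algebra (verts \<Gamma>)
     (insert (adjacency_matrix \<Gamma>)
       {diag_idem (sphere_at \<Gamma> x0 k) | k. k \<le> eccentricity \<Gamma> x0})"

definition T3 :: "'a graph \<Rightarrow> 'a \<Rightarrow> 'a cmatrix set" where
  "T3 \<Gamma> x0 = generated_algebra (verts \<Gamma>)
     (insert (adjacency_matrix \<Gamma>) {diag_idem Y | Y. Y \<in> stabilizer_orbits \<Gamma> x0})"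

definition T4 :: "'a graph \<Rightarrow> 'a \<Rightarrow> 'a cmatrix set" where
  "T4 \<Gamma> x0 =
     {M \<in> matrices (verts \<Gamma>).
        \<forall>x\<in>verts \<Gamma>. \<forall>y\<in>verts \<Gamma>. \<forall>\<sigma>\<in>stabilizer \<Gamma> x0. M (\<sigma> x) (\<sigma> y) = M x y}"

end

theory Submission
  imports Defs
begin

(* Let B be a unital subalgebra containing A and the idempotents of the spheres around m. As
   n >= 2m, the last sphere is {n}. Cutting A by the idempotents of the sphere of radius k and of
   {m+k+1} leaves exactly the matrix unit at (m+k, m+k+1), so by descent B contains the
   idempotents of all vertices m+k, and by subtraction those of all vertices m-k. As the path is
   connected, B is the full matrix algebra. This applies to T2 and, because stabilizers preserve
   distances, to T4. Hence T4 contains the idempotent of each vertex, which forces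
   the stabilizer to be trivial; its orbits are singletons and T3 is full as well. *)

section \<open>Matrix units and products with diagonal idempotents\<close>

definition matrix_unit :: "'a \<Rightarrow> 'a \<Rightarrow> 'a cmatrix" where
  "matrix_unit i j = (\<lambda>x y. if x = i \<and> y = j then 1 else 0)"

lemma diag_idem_singleton: "diag_idem {x} = matrix_unit x x"
  by (auto simp: diag_idem_def matrix_unit_def fun_eq_iff)

lemma mat_mult_matrix_unit:
  assumes "finite X" and "j \<in> X"
  shows "mat_mult X (matrix_unit i j) (matrix_unit j l) = matrix_unit i l"
proof (intro ext)
  fix x y
  have "mat_mult X (matrix_unit i j) (matrix_unit j l) x y =
      (\<Sum>z\<in>X. if z = j then (if x = i \<and> y = l then 1 else 0) else 0)"
    unfolding mat_mult_def matrix_unit_def by (intro sum.cong) auto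
  also have "\<dots> = matrix_unit i l x y"
    using assms by (simp add: matrix_unit_def)
  finally show "mat_mult X (matrix_unit i j) (matrix_unit j l) x y = matrix_unit i l x y" .
qed

lemma mat_mult_diag_idem_left:
  assumes "finite X" and "Y \<subseteq> X"
  shows "mat_mult X (diag_idem Y) M = (\<lambda>x y. if x \<in> Y then M x y else 0)"
proof (intro ext)
  fix x y
  have "mat_mult X (diag_idem Y) M x y =
      (\<Sum>z\<in>X. if z = x then (if x \<in> Y then M x y else 0) else 0)"
    unfolding mat_mult_def diag_idem_def by (intro sum.cong) auto
  also have "\<dots> = (if x \<in> Y then M x y else 0)"
    using assms by auto
  finally show "mat_mult X (diag_idem Y) M x y = (if x \<in> Y then M x y else 0)" .
qed

lemma mat_mult_diag_idem_right:
  assumes "finite X" and "Y \<subseteq> X"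
  shows "mat_mult X M (diag_idem Y) = (\<lambda>x y. if y \<in> Y then M x y else 0)"
proof (intro ext)
  fix x y
  have "mat_mult X M (diag_idem Y) x y =
      (\<Sum>z\<in>X. if z = y then (if y \<in> Y then M x y else 0) else 0)"
    unfolding mat_mult_def diag_idem_def by (intro sum.cong) auto
  also have "\<dots> = (if y \<in> Y then M x y else 0)"
    using assms by auto
  finally show "mat_mult X M (diag_idem Y) x y = (if y \<in> Y then M x y else 0)" .
qed

section \<open>Closure properties of unital subalgebras and criteria for being the full matrix
  algebra\<close>

locale matrix_subalgebra =
  fixes X :: "'a set" and B :: "'a cmatrix set"
  assumes finite_index: "finite X" and subalgebra: "unital_subalgebra X B"
begin

lemma add_closed: "M \<in> B \<Longrightarrow> N \<in> B \<Longrightarrow> (\<lambda>x y. M x y + N x y) \<in> B"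
  and scale_closed: "M \<in> B \<Longrightarrow> (\<lambda>x y. c * M x y) \<in> B"
  and mult_closed: "M \<in> B \<Longrightarrow> N \<in> B \<Longrightarrow> mat_mult X M N \<in> B"
  and one_closed: "diag_idem X \<in> B"
  and subset_matrices: "B \<subseteq> matrices X"
  using subalgebra by (auto simp: unital_subalgebra_def)

lemma diff_closed:
  assumes "M \<in> B" and "N \<in> B"
  shows "(\<lambda>x y. M x y - N x y) \<in> B"
  using add_closed[OF assms(1) scale_closed[OF assms(2), of "-1"]] by simp

lemma sum_closed:
  assumes "finite I" and "\<And>i. i \<in> I \<Longrightarrow> F i \<in> B"
  shows "(\<lambda>x y. \<Sum>i\<in>I. F i x y) \<in> B"
  using assms
proof (induction I rule: finite_induct)
  case empty
  \<comment> \<open>The zero matrix is not listed in \<open>unital_subalgebra\<close>; it arises as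
    0 times the identity.\<close>
  show ?case using scale_closed[OF one_closed, of 0] by simp
next
  case (insert i I)
  then show ?case using add_closed[of "F i"] by simp
qed

text \<open>The cut is the product of \<open>diag_idem Y\<close>, \<open>M\<close> and
  \<open>diag_idem Z\<close>. With well-chosen \<open>Y\<close> and \<open>Z\<close> it isolates a
  single entry of the adjacency matrix.\<close>

lemma corner_closed:
  assumes "M \<in> B" and "diag_idem Y \<in> B" and "diag_idem Z \<in> B" and "Y \<subseteq> X" and "Z \<subseteq> X"
  shows "(\<lambda>x y. if x \<in> Y \<and> y \<in> Z then M x y else 0) \<in> B"
proof -
  have "(\<lambda>x y. if x \<in> Y \<and> y \<in> Z then M x y else 0) =
      mat_mult X (mat_mult X (diag_idem Y) M) (diag_idem Z)"
    using assms(4,5) finite_index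
    by (auto simp: mat_mult_diag_idem_left mat_mult_diag_idem_right fun_eq_iff)
  then show ?thesis using assms(1-3) by (simp add: mult_closed)
qed

text \<open>The matrix units span: each \<open>M\<close> is the sum of
  \<open>M i j * matrix_unit i j\<close>. Membership in \<open>matrices X\<close> makes this
  identity hold at indices outside \<open>X\<close> too.\<close>

lemma eq_matrices:
  assumes "\<And>i j. i \<in> X \<Longrightarrow> j \<in> X \<Longrightarrow> matrix_unit i j \<in> B"
  shows "B = matrices X"
proof
  show "matrices X \<subseteq> B"
  proof
    fix M :: "'a cmatrix" assume M: "M \<in> matrices X"
    have "M x y = (\<Sum>i\<in>X. \<Sum>j\<in>X. M i j * matrix_unit i j x y)" for x y
    proof -
      have "(\<Sum>i\<in>X. \<Sum>j\<in>X. M i j * matrix_unit i j x y) =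
          (\<Sum>i\<in>X. \<Sum>j\<in>X. if y = j then (if x = i then M i j else 0) else 0)"
        unfolding matrix_unit_def by (intro sum.cong) auto
      also have "\<dots> = M x y"
        using M finite_index by (cases "y \<in> X") (auto simp: matrices_def)
      finally show ?thesis by simp
    qed
    then have "M = (\<lambda>x y. \<Sum>i\<in>X. \<Sum>j\<in>X. M i j * matrix_unit i j x y)"
      by blast
    also have "\<dots> \<in> B"
      using finite_index assms by (intro sum_closed scale_closed)
    finally show "M \<in> B" .
  qed
qed (rule subset_matrices)

end

locale graph_subalgebra = matrix_subalgebra "verts \<Gamma>" B
  for \<Gamma> :: "'a graph" and B +
  assumes arcs_subset: "arcs \<Gamma> \<subseteq> verts \<Gamma> \<times> verts \<Gamma>"
    and adjacency_closed: "adjacency_matrix \<Gamma> \<in> B"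
begin

text \<open>For an arc from \<open>y\<close> to \<open>z\<close>, cutting the adjacency matrix by
  the two vertex idempotents leaves \<open>matrix_unit y z\<close>. Multiplying these units along a
  walk from \<open>i\<close> to \<open>j\<close> gives \<open>matrix_unit i j\<close>.\<close>

lemma eq_matrices_if_connected:
  assumes vertices: "\<And>x. x \<in> verts \<Gamma> \<Longrightarrow> diag_idem {x} \<in> B"
    and connected: "\<And>x y. x \<in> verts \<Gamma> \<Longrightarrow> y \<in> verts \<Gamma> \<Longrightarrow> (x, y) \<in> (arcs \<Gamma>)\<^sup>*"
  shows "B = matrices (verts \<Gamma>)"
proof (rule eq_matrices)
  fix i j assume i: "i \<in> verts \<Gamma>" and j: "j \<in> verts \<Gamma>"
  from connected[OF i j] show "matrix_unit i j \<in> B"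
  proof (induction rule: rtrancl_induct)
    case base
    show ?case using vertices[OF i] by (simp add: diag_idem_singleton)
  next
    case (step y z)
    then have y: "y \<in> verts \<Gamma>" and z: "z \<in> verts \<Gamma>" using arcs_subset by auto
    have "(\<lambda>u v. if u \<in> {y} \<and> v \<in> {z} then adjacency_matrix \<Gamma> u v else 0) \<in> B"
      using y z adjacency_closed vertices by (intro corner_closed) auto
    also have "(\<lambda>u v. if u \<in> {y} \<and> v \<in> {z} then adjacency_matrix \<Gamma> u v else 0) = matrix_unit y z"
      using step y z by (auto simp: fun_eq_iff matrix_unit_def adjacency_matrix_def arcs_def)
    finally show ?case
      using mult_closed[OF step.IH] mat_mult_matrix_unit[OF finite_index y] by metis
  qed
qed

end

section \<open>Automorphisms, the stabilizer of the base vertex and the algebra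
  \<open>T4\<close>\<close>

lemma automorphism_arcs:
  assumes "\<sigma> \<in> automorphisms \<Gamma>" and "x \<in> verts \<Gamma>" and "y \<in> verts \<Gamma>"
  shows "(\<sigma> x, \<sigma> y) \<in> arcs \<Gamma> \<longleftrightarrow> (x, y) \<in> arcs \<Gamma>"
  using assms by (simp add: automorphisms_def arcs_def)

lemma automorphism_walks:
  assumes "arcs \<Gamma> \<subseteq> verts \<Gamma> \<times> verts \<Gamma>" and \<sigma>: "\<sigma> \<in> automorphisms \<Gamma>"
    and "x \<in> verts \<Gamma>" and "y \<in> verts \<Gamma>"
  shows "(\<sigma> x, \<sigma> y) \<in> arcs \<Gamma> ^^ k \<longleftrightarrow> (x, y) \<in> arcs \<Gamma> ^^ k"
  using assms(4)
proof (induction k arbitrary: y)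
  case 0
  have "inj \<sigma>" using \<sigma> by (auto simp: automorphisms_def permutes_inj)
  then show ?case by (auto simp: inj_eq)
next
  case (Suc k)
  have perm: "\<sigma> permutes verts \<Gamma>" using \<sigma> by (simp add: automorphisms_def)
  \<comment> \<open>The last intermediate vertex of the walk is a vertex of the graph, hence of the
    form \<open>\<sigma> z\<close> by surjectivity. This yields both directions without the inverse
    of \<open>\<sigma>\<close>.\<close>
  have "(\<sigma> x, \<sigma> y) \<in> arcs \<Gamma> ^^ Suc k \<longleftrightarrow>
      (\<exists>w\<in>\<sigma> ` verts \<Gamma>. (\<sigma> x, w) \<in> arcs \<Gamma> ^^ k \<and> (w, \<sigma> y) \<in> arcs \<Gamma>)"
    using assms(1) by (auto simp: permutes_image[OF perm])
  also have "\<dots> \<longleftrightarrow> (\<exists>w\<in>verts \<Gamma>. (x, w) \<in> arcs \<Gamma> ^^ k \<and> (w, y) \<in> arcs \<Gamma>)"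
    using Suc automorphism_arcs[OF \<sigma>] by auto
  also have "\<dots> \<longleftrightarrow> (x, y) \<in> arcs \<Gamma> ^^ Suc k"
    using assms(1) by auto
  finally show ?case .
qed

text \<open>As \<open>\<sigma>\<close> fixes \<open>x0\<close>, walks from \<open>x0\<close> to
  \<open>x\<close> and from \<open>x0\<close> to \<open>\<sigma> x\<close> have the same possible
  lengths, so the two \<open>LEAST\<close> values agree.\<close>

lemma stabilizer_sphere_at:
  assumes "arcs \<Gamma> \<subseteq> verts \<Gamma> \<times> verts \<Gamma>" and "x0 \<in> verts \<Gamma>"
    and "\<sigma> \<in> stabilizer \<Gamma> x0" and "x \<in> verts \<Gamma>"
  shows "\<sigma> x \<in> sphere_at \<Gamma> x0 k \<longleftrightarrow> x \<in> sphere_at \<Gamma> x0 k"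
proof -
  have \<sigma>: "\<sigma> \<in> automorphisms \<Gamma>" "\<sigma> x0 = x0" and perm: "\<sigma> permutes verts \<Gamma>"
    using assms(3) by (auto simp: stabilizer_def automorphisms_def)
  have "graph_dist \<Gamma> x0 (\<sigma> x) = graph_dist \<Gamma> x0 x"
    using automorphism_walks[OF assms(1) \<sigma>(1) assms(2,4)] \<sigma>(2) by (simp add: graph_dist_def)
  then show ?thesis
    using assms(4) by (auto simp: sphere_at_def permutes_in_image[OF perm])
qed

text \<open>\<open>T4\<close> is the centralizer algebra of the stabilizer acting by permutation
  matrices. Closure under products comes from reindexing the inner sum by
  \<open>\<sigma>\<close>.\<close>

lemma unital_subalgebra_T4:
  "unital_subalgebra (verts \<Gamma>) (T4 \<Gamma> x0)"
  unfolding unital_subalgebra_def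
proof (intro conjI ballI allI)
  have perm: "\<sigma> permutes verts \<Gamma>" if "\<sigma> \<in> stabilizer \<Gamma> x0" for \<sigma>
    using that by (simp add: stabilizer_def automorphisms_def)
  show "T4 \<Gamma> x0 \<subseteq> matrices (verts \<Gamma>)" by (auto simp: T4_def)
  show "diag_idem (verts \<Gamma>) \<in> T4 \<Gamma> x0"
    using permutes_in_image[OF perm] permutes_inj[OF perm]
    by (auto simp: T4_def diag_idem_def matrices_def inj_eq)
  fix M assume M: "M \<in> T4 \<Gamma> x0"
  show "(\<lambda>x y. c * M x y) \<in> T4 \<Gamma> x0" for c
    using M by (auto simp: T4_def matrices_def)
  fix N assume N: "N \<in> T4 \<Gamma> x0"
  show "(\<lambda>x y. M x y + N x y) \<in> T4 \<Gamma> x0"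
    using M N by (auto simp: T4_def matrices_def)
  have "mat_mult (verts \<Gamma>) M N (\<sigma> x) (\<sigma> y) = mat_mult (verts \<Gamma>) M N x y"
    if "\<sigma> \<in> stabilizer \<Gamma> x0" and "x \<in> verts \<Gamma>" and "y \<in> verts \<Gamma>" for \<sigma> x y
  proof -
    have "mat_mult (verts \<Gamma>) M N (\<sigma> x) (\<sigma> y) =
        (\<Sum>z\<in>verts \<Gamma>. M (\<sigma> x) (\<sigma> z) * N (\<sigma> z) (\<sigma> y))"
      unfolding mat_mult_def
      by (rule sum.reindex_bij_betw[OF permutes_imp_bij[OF perm[OF that(1)]], symmetric])
    also have "\<dots> = mat_mult (verts \<Gamma>) M N x y"
      unfolding mat_mult_def using M N that by (intro sum.cong) (auto simp: T4_def)
    finally show ?thesis .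
  qed
  moreover have "mat_mult (verts \<Gamma>) M N \<in> matrices (verts \<Gamma>)"
    using M N by (auto simp: T4_def matrices_def mat_mult_def)
  ultimately show "mat_mult (verts \<Gamma>) M N \<in> T4 \<Gamma> x0"
    by (auto simp: T4_def)
qed

lemma adjacency_matrix_T4: "adjacency_matrix \<Gamma> \<in> T4 \<Gamma> x0"
  using permutes_in_image
  by (fastforce simp: T4_def stabilizer_def automorphisms_def adjacency_matrix_def matrices_def)

lemma diag_idem_sphere_at_T4:
  assumes "arcs \<Gamma> \<subseteq> verts \<Gamma> \<times> verts \<Gamma>" and "x0 \<in> verts \<Gamma>"
  shows "diag_idem (sphere_at \<Gamma> x0 k) \<in> T4 \<Gamma> x0"
proof -
  have "inj \<sigma>" if "\<sigma> \<in> stabilizer \<Gamma> x0" for \<sigma>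
    using that by (auto simp: stabilizer_def automorphisms_def intro: permutes_inj)
  then have "diag_idem (sphere_at \<Gamma> x0 k) (\<sigma> x) (\<sigma> y) = diag_idem (sphere_at \<Gamma> x0 k) x y"
    if "\<sigma> \<in> stabilizer \<Gamma> x0" and "x \<in> verts \<Gamma>" for \<sigma> x y
    using that stabilizer_sphere_at[OF assms that] by (auto simp: diag_idem_def inj_eq)
  moreover have "diag_idem (sphere_at \<Gamma> x0 k) \<in> matrices (verts \<Gamma>)"
    by (auto simp: matrices_def diag_idem_def sphere_at_def)
  ultimately show ?thesis by (auto simp: T4_def)
qed

text \<open>Invariance of \<open>diag_idem {x}\<close> at the entry \<open>(x, x)\<close>, which is
  1, forces \<open>\<sigma> x\<close> to lie in \<open>{x}\<close>.\<close>

lemma stabilizer_trivial_if_T4_full: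
  assumes "T4 \<Gamma> x0 = matrices (verts \<Gamma>)" and "\<sigma> \<in> stabilizer \<Gamma> x0" and x: "x \<in> verts \<Gamma>"
  shows "\<sigma> x = x"
proof -
  have "diag_idem {x} \<in> T4 \<Gamma> x0"
    using x by (auto simp: assms(1) matrices_def diag_idem_def)
  then have "diag_idem {x} (\<sigma> x) (\<sigma> x) = diag_idem {x} x x"
    using assms(2) x by (auto simp: T4_def)
  then show ?thesis by (simp add: diag_idem_def split: if_splits)
qed

lemma id_in_stabilizer: "id \<in> stabilizer \<Gamma> x0"
  by (simp add: stabilizer_def automorphisms_def permutes_id)

lemma stabilizer_orbits_singletons:
  assumes "T4 \<Gamma> x0 = matrices (verts \<Gamma>)"
  shows "stabilizer_orbits \<Gamma> x0 = {{x} | x. x \<in> verts \<Gamma>}"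
proof -
  have "{\<sigma> x | \<sigma>. \<sigma> \<in> stabilizer \<Gamma> x0} = {x}" if "x \<in> verts \<Gamma>" for x
    using stabilizer_trivial_if_T4_full[OF assms _ that] id_in_stabilizer[of \<Gamma> x0]
    by (auto intro!: exI[of _ id])
  then show ?thesis unfolding stabilizer_orbits_def by auto
qed

lemma adjacency_matrix_matrices: "adjacency_matrix \<Gamma> \<in> matrices (verts \<Gamma>)"
  by (auto simp: adjacency_matrix_def matrices_def)

lemma diag_idem_matrices: "Y \<subseteq> X \<Longrightarrow> diag_idem Y \<in> matrices X"
  by (auto simp: diag_idem_def matrices_def)

lemma generated_algebra_superset: "S \<subseteq> generated_algebra X S"
  unfolding generated_algebra_def by (rule hull_subset)

section \<open>Walks, distances and spheres in the path graph\<close>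

lemma verts_path_graph: "verts (path_graph n) = {1..n}"
  by (simp add: path_graph_def)

lemma arcs_path_graph:
  "(x, y) \<in> arcs (path_graph n) \<longleftrightarrow> x \<in> {1..n} \<and> y \<in> {1..n} \<and> (y = Suc x \<or> x = Suc y)"
proof -
  have "\<bar>int x - int y\<bar> = 1 \<longleftrightarrow> y = Suc x \<or> x = Suc y" for x y by linarith
  then show ?thesis by (auto simp: arcs_def path_graph_def doubleton_eq_iff)
qed

lemma arcs_path_graph_subset:
  "arcs (path_graph n) \<subseteq> verts (path_graph n) \<times> verts (path_graph n)"
  by (auto simp: arcs_path_graph verts_path_graph)

text \<open>Each arc changes the vertex number by exactly one. This is the lower bound for the
  distance; the monotone walks below attain it.\<close>

lemma path_graph_walk_bound:
  "(x, y) \<in> arcs (path_graph n) ^^ k \<Longrightarrow> \<bar>int x - int y\<bar> \<le> int k"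
proof (induction k arbitrary: y)
  case (Suc k)
  then obtain z where "(x, z) \<in> arcs (path_graph n) ^^ k" "(z, y) \<in> arcs (path_graph n)" by auto
  with Suc.IH show ?case by (force simp: arcs_path_graph)
qed simp

lemma path_graph_walk_up:
  "x \<ge> 1 \<Longrightarrow> x + d \<le> n \<Longrightarrow> (x, x + d) \<in> arcs (path_graph n) ^^ d"
proof (induction d)
  case (Suc d)
  then show ?case by (auto simp: arcs_path_graph intro!: relcompI[of _ "x + d"])
qed simp

lemma path_graph_walk_down:
  "x \<ge> 1 \<Longrightarrow> x + d \<le> n \<Longrightarrow> (x + d, x) \<in> arcs (path_graph n) ^^ d"
proof (induction d)
  case (Suc d)
  \<comment> \<open>The new arc comes first in the descending walk, whence
    \<open>relpow_Suc_I2\<close>.\<close>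
  then have "(x + Suc d, x + d) \<in> arcs (path_graph n)" by (auto simp: arcs_path_graph)
  with Suc show ?case by (intro relpow_Suc_I2) auto
qed simp

lemma path_graph_geodesic:
  assumes "x \<in> {1..n}" and "y \<in> {1..n}"
  shows "(x, y) \<in> arcs (path_graph n) ^^ nat \<bar>int x - int y\<bar>"
proof (cases "x \<le> y")
  case True
  then show ?thesis using path_graph_walk_up[of x "y - x" n] assms by (simp add: nat_diff_distrib)
next
  case False
  then show ?thesis using path_graph_walk_down[of y "x - y" n] assms by (simp add: nat_diff_distrib)
qed

lemma path_graph_connected:
  assumes "x \<in> {1..n}" and "y \<in> {1..n}"
  shows "(x, y) \<in> (arcs (path_graph n))\<^sup>*"
  using path_graph_geodesic[OF assms] by (rule relpow_imp_rtrancl)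

lemma graph_dist_path_graph:
  assumes "x \<in> {1..n}" and "y \<in> {1..n}"
  shows "graph_dist (path_graph n) x y = nat \<bar>int x - int y\<bar>"
  unfolding graph_dist_def
proof (rule Least_equality)
  show "(x, y) \<in> arcs (path_graph n) ^^ nat \<bar>int x - int y\<bar>"
    by (rule path_graph_geodesic[OF assms])
qed (use path_graph_walk_bound in fastforce)

lemma sphere_at_path_graph:
  assumes "m \<in> {1..n}"
  shows "sphere_at (path_graph n) m k = {x \<in> {1..n}. x = m + k \<or> x + k = m}"
  using assms by (auto simp: sphere_at_def verts_path_graph graph_dist_path_graph)

lemma eccentricity_ge:
  assumes "finite (verts \<Gamma>)" and "x \<in> verts \<Gamma>"
  shows "graph_dist \<Gamma> x0 x \<le> eccentricity \<Gamma> x0"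
  unfolding eccentricity_def using assms by (intro Max_ge) auto

text \<open>The vertex \<open>m + k\<close> is at distance \<open>k\<close>. Hence
  \<open>T2\<close>, whose radii stop at the eccentricity, has the idempotents of all spheres that
  reach the right arm.\<close>

lemma eccentricity_path_graph_ge:
  assumes "m \<in> {1..n}" and "m + k \<le> n"
  shows "k \<le> eccentricity (path_graph n) m"
  using eccentricity_ge[of "path_graph n" "m + k" m] assms
  by (simp add: verts_path_graph graph_dist_path_graph)

text \<open>The bound on \<open>n\<close> makes the right arm strictly longer than the left one, so
  it breaks the mirror symmetry about \<open>m\<close>. Spheres of radius at most
  \<open>n - m\<close> suffice.\<close>

lemma path_subalgebra_full:
  assumes m: "m \<in> {1..n}" and n: "n > 2 * m - 1"
    and alg: "unital_subalgebra {1..n} B" and A: "adjacency_matrix (path_graph n) \<in> B"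
    and spheres: "\<And>k. m + k \<le> n \<Longrightarrow> diag_idem (sphere_at (path_graph n) m k) \<in> B"
  shows "B = matrices {1..n}"
proof -
  interpret graph_subalgebra "path_graph n" B
    by unfold_locales
      (use alg A arcs_path_graph_subset in \<open>auto simp: verts_path_graph\<close>)
  have right: "diag_idem {m + k} \<in> B" if "k \<le> n - m" for k
    using that
  \<comment> \<open>Descending induction, from the end vertex \<open>n\<close> back to
    \<open>m\<close>.\<close>
  proof (induction rule: inc_induct)
    case base
    \<comment> \<open>A second vertex would be \<open>2 * m - n\<close>, which is not positive
      because \<open>n\<close> is at least \<open>2 * m\<close>.\<close>
    have "sphere_at (path_graph n) m (n - m) = {m + (n - m)}"
      using m n by (auto simp: sphere_at_path_graph)
    then show ?case using spheres[of "n - m"] m by simp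
  next
    case (step k)
    let ?S = "sphere_at (path_graph n) m k" and ?A = "adjacency_matrix (path_graph n)"
    have k: "m + Suc k \<le> n" using step.hyps m by auto
    have S: "diag_idem ?S \<in> B" using k by (intro spheres) simp
    have sub: "?S \<subseteq> verts (path_graph n)" "{m + Suc k} \<subseteq> verts (path_graph n)"
      using k by (auto simp: sphere_at_def verts_path_graph)
    have entry: "?A u v = (if (u, v) \<in> arcs (path_graph n) then 1 else 0)" for u v
      using arcs_path_graph_subset[of n] by (auto simp: adjacency_matrix_def arcs_def)
    \<comment> \<open>The other candidate row \<open>m - k\<close> differs from
      \<open>m + Suc k\<close> by \<open>2 * k + 1\<close>. It is adjacent only if
      \<open>k = 0\<close>, and then it coincides with \<open>m + k\<close>.\<close>
    have "(\<lambda>u v. if u \<in> ?S \<and> v \<in> {m + Suc k} then ?A u v else 0) = matrix_unit (m + k) (m + Suc k)"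
      using k m by (auto simp: fun_eq_iff matrix_unit_def entry arcs_path_graph sphere_at_path_graph)
    then have up: "matrix_unit (m + k) (m + Suc k) \<in> B"
      using corner_closed[OF A S step.IH sub] by simp
    have "(\<lambda>u v. if u \<in> {m + Suc k} \<and> v \<in> ?S then ?A u v else 0) = matrix_unit (m + Suc k) (m + k)"
      using k m by (auto simp: fun_eq_iff matrix_unit_def entry arcs_path_graph sphere_at_path_graph)
    then have "matrix_unit (m + Suc k) (m + k) \<in> B"
      using corner_closed[OF A step.IH S sub(2,1)] by simp
    \<comment> \<open>The step up followed by the step down is the idempotent of
      \<open>m + k\<close>.\<close>
    from mult_closed[OF up this] show ?case
      using mat_mult_matrix_unit[OF finite_index, of "m + Suc k" "m + k" "m + k"] sub(2)
      by (simp add: diag_idem_singleton)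
  qed
  have "diag_idem {x} \<in> B" if x: "x \<in> {1..n}" for x
  proof (cases "m \<le> x")
    case True
    then show ?thesis using right[of "x - m"] x by (simp add: diff_le_mono)
  next
    case False
    define k where "k = m - x"
    have k: "x + k = m" "k > 0" using False by (auto simp: k_def)
    \<comment> \<open>Since \<open>x\<close> is at least 1, \<open>k\<close> is at most
      \<open>m - 1\<close> and \<open>m + k\<close> at most \<open>2 * m - 1\<close>: the mirror
      image of \<open>x\<close> exists.\<close>
    have len: "m + k \<le> n" using k n x by auto
    have S: "sphere_at (path_graph n) m k = {x, m + k}"
      using x m k len by (auto simp: sphere_at_path_graph)
    have "(\<lambda>u v. diag_idem {x, m + k} u v - diag_idem {m + k} u v) \<in> B"
      using spheres[OF len] right[of k] len S by (intro diff_closed) auto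
    also have "(\<lambda>u v. diag_idem {x, m + k} u v - diag_idem {m + k} u v) = diag_idem {x}"
      using k by (auto simp: diag_idem_def fun_eq_iff)
    finally show ?thesis .
  qed
  then show ?thesis
    using eq_matrices_if_connected path_graph_connected by (simp add: verts_path_graph)
qed

theorem theorem7p3:
  fixes n m :: nat
  assumes "n \<ge> 2" and "m \<in> {1..n}" and "n > 2 * m - 1"
  shows "T2 (path_graph n) m = T3 (path_graph n) m \<and>
         T3 (path_graph n) m = T4 (path_graph n) m \<and>
         T4 (path_graph n) m = matrices {1..n}"
proof -
  let ?P = "path_graph n"
  have m: "m \<in> verts ?P" using assms(2) by (simp add: verts_path_graph)
  have T2: "T2 ?P m = matrices {1..n}"
  proof (rule path_subalgebra_full[OF assms(2,3)])
    have "sphere_at ?P m k \<subseteq> verts ?P" for k by (auto simp: sphere_at_def)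
    then show "unital_subalgebra {1..n} (T2 ?P m)"
      unfolding T2_def verts_path_graph[symmetric]
      by (intro unital_subalgebra_generated)
        (auto intro: adjacency_matrix_matrices diag_idem_matrices)
    show "adjacency_matrix ?P \<in> T2 ?P m"
      unfolding T2_def by (rule subsetD[OF generated_algebra_superset]) simp
    show "diag_idem (sphere_at ?P m k) \<in> T2 ?P m" if "m + k \<le> n" for k
      unfolding T2_def using eccentricity_path_graph_ge[OF assms(2) that]
      by (intro subsetD[OF generated_algebra_superset]) auto
  qed
  have T4: "T4 ?P m = matrices {1..n}"
    using unital_subalgebra_T4[of ?P m] adjacency_matrix_T4
      diag_idem_sphere_at_T4[OF arcs_path_graph_subset m]
    by (intro path_subalgebra_full[OF assms(2,3)]) (simp_all add: verts_path_graph)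
  \<comment> \<open>Fullness of \<open>T4\<close> makes the stabilizer trivial on vertices. The
    generators of \<open>T3\<close> are thus the adjacency matrix and all vertex idempotents, and
    connectedness suffices without another descent.\<close>
  have orbits: "stabilizer_orbits ?P m = {{x} | x. x \<in> verts ?P}"
    using T4 by (intro stabilizer_orbits_singletons) (simp add: verts_path_graph)
  have "unital_subalgebra (verts ?P) (T3 ?P m)"
    unfolding T3_def orbits
    by (intro unital_subalgebra_generated)
      (auto intro!: adjacency_matrix_matrices diag_idem_matrices)
  moreover have "adjacency_matrix ?P \<in> T3 ?P m"
    unfolding T3_def by (rule subsetD[OF generated_algebra_superset]) simp
  ultimately interpret T3: graph_subalgebra ?P "T3 ?P m"
    by unfold_locales (auto simp: verts_path_graph arcs_path_graph)
  have "diag_idem {x} \<in> T3 ?P m" if "x \<in> verts ?P" for x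
    unfolding T3_def orbits using that
    by (intro subsetD[OF generated_algebra_superset]) auto
  then have "T3 ?P m = matrices {1..n}"
    using T3.eq_matrices_if_connected path_graph_connected by (simp add: verts_path_graph)
  with T2 T4 show ?thesis by simp
qed

end
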